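(* Let $\mathrm{st}:\mathfrak{S}\to\mathbb{N}$ be a permutation statistic with $\mathrm{st}(\epsilon)=0$ for which there is a function $f:\mathbb{N}^2\to\mathbb{N}$ such that for all integers $0\le k\le n$ and all $\sigma_1\in\mathfrak{S}_k(312)$, $\sigma_2\in\mathfrak{S}_{n-k}(312)$, the permutation $\sigma=213[\sigma_1,1,\sigma_2]$ satisfies $$\mathrm{st}(\sigma)=f(k,n-k)+\mathrm{st}(\sigma_1)+\mathrm{st}(\sigma_2).$$ Let $\pi$ be a $312$-avoiding permutation with block decomposition $\pi=\iota_r[\pi_{1*},\dots,\pi_{r*}]$, and let $\Pi=\{312,\pi\}$. Then for all $n\ge 0$ $$F^{\mathrm{st}}_{n+1}(\Pi;q)=\sum_{k=0}^n q^{f(k,n-k)}\Bigg[\sum_{i=1}^r F^{\mathrm{st}}_k(\{312,\underline{\pi}(i)\};q)\,F^{\mathrm{st}}_{n-k}(\{312,\overline{\pi}(i)\};q)-\sum_{i=1}^{r-1}F^{\mathrm{st}}_k(\{312,\underline{\pi}(i)\};q)\,F^{\mathrm{st}}_{n-k}(\{312,\overline{\pi}(i+1)\};q)\Bigg],$$ where $F^{\mathrm{st}}_0(\Pi;q)=0$ if $\pi=\epsilon$, and $F^{\mathrm{st}}_0(\Pi;q)=1$ otherwise.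
   Context: $\mathbb{N}$ is the set of nonnegative integers. $\mathfrak{S}_n$ is the set of permutations of $\{1,\dots,n\}$ in one-line notation, $\mathfrak{S}=\bigcup_{n\ge 0}\mathfrak{S}_n$, and $\mathfrak{S}_0=\{\epsilon\}$ with $\epsilon$ the empty permutation. A permutation $\sigma$ contains $\pi$ if some subsequence of $\sigma$ has the same relative order as $\pi$ (so every permutation contains $\epsilon$); otherwise $\sigma$ avoids $\pi$. For $\Pi\subseteq\mathfrak{S}$, $\mathfrak{S}_n(\Pi)$ is the set of $\sigma\in\mathfrak{S}_n$ avoiding every pattern in $\Pi$; $\mathfrak{S}_n(312)=\mathfrak{S}_n(\{312\})$. For a statistic $\mathrm{st}:\mathfrak{S}\to\mathbb{N}$, $F^{\mathrm{st}}_n(\Pi;q)=\sum_{\sigma\in\mathfrak{S}_n(\Pi)}q^{\mathrm{st}(\sigma)}$. For $\tau\in\mathfrak{S}_k$ and $\sigma_1,\dots,\sigma_k\in\mathfrak{S}$, the inflation $\tau[\sigma_1,\dots,\sigma_k]$ is the permutation that is a concatenation of $k$ consecutive blocks of positions, the $i$-th block (of length $|\sigma_i|$) having the relative order of $\sigma_i$ and occupying an interval of values, with the blocks' value intervals arranged relative to one another in the order of $\tau$; e.g. $213[123,1,21]=234165$. $\iota_r=12\cdots r$ is the identity of $\mathfrak{S}_r$ (and $\iota_0[\,]=\epsilon$). For $\pi\in\mathfrak{S}_m$, $\pi_*:=21[\pi,1]$, i.e. $\pi_*=(\pi(1)+1)\cdots(\pi(m)+1)\,1$; and $\pi_{i*}=(\pi_i)_*$.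 Every $312$-avoiding permutation $\pi$ can be written uniquely as $\pi=\iota_r[\pi_{1*},\dots,\pi_{r*}]$ with $r\ge 0$ and each $\pi_i$ a $312$-avoiding permutation; this is its block decomposition. For $1\le i\le r$ define $\underline{\pi}(1)=\pi_1$, $\underline{\pi}(i)=\iota_i[\pi_{1*},\dots,\pi_{i*}]$ for $i\ge 2$, and $\overline{\pi}(i)=\iota_{r-i+1}[\pi_{i*},\dots,\pi_{r*}]$ for $1\le i\le r$. *)

theory Defs
  imports
    "HOL-Combinatorics.Multiset_Permutations"
    "HOL-Library.Sublist"
    "HOL-Computational_Algebra.Polynomial"
begin

text \<open>A permutation of $\{1,\dots,n\}$ is represented by its one-line notation,
  a \<^typ>\<open>nat list\<close>; the empty permutation is \<^term>\<open>[]\<close>.\<close>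

definition perms :: "nat \<Rightarrow> nat list set" where
  "perms n = permutations_of_set {1..n}"

definition all_perms :: "nat list set" where
  "all_perms = (\<Union>n. perms n)"

definition same_relative_order :: "nat list \<Rightarrow> nat list \<Rightarrow> bool" where
  "same_relative_order xs ys \<longleftrightarrow>
     length xs = length ys \<and>
     (\<forall>i<length xs. \<forall>j<length xs. xs ! i < xs ! j \<longleftrightarrow> ys ! i < ys ! j)"

definition contains :: "nat list \<Rightarrow> nat list \<Rightarrow> bool" where
  "contains \<sigma> \<pi> \<longleftrightarrow> (\<exists>xs. subseq xs \<sigma> \<and> same_relative_order xs \<pi>)"

definition avoids :: "nat list \<Rightarrow> nat list \<Rightarrow> bool" where
  "avoids \<sigma> \<pi> \<longleftrightarrow> \<not> contains \<sigma> \<pi>"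

definition avoiders :: "nat \<Rightarrow> nat list set \<Rightarrow> nat list set" where
  "avoiders n Pats = {\<sigma> \<in> perms n. \<forall>\<pi>\<in>Pats. avoids \<sigma> \<pi>}"

text \<open>The generating polynomial of a statistic, in the formal variable $q$. Integer
  coefficients are used because the recurrence involves a genuine subtraction. Only the
  values of the statistic on permutations matter.\<close>

definition gen_poly :: "(nat list \<Rightarrow> nat) \<Rightarrow> nat \<Rightarrow> nat list set \<Rightarrow> int poly" where
  "gen_poly st n Pats = (\<Sum>\<sigma>\<in>avoiders n Pats. monom 1 (st \<sigma>))"

text \<open>Inflation $\tau[\sigma_1,\dots,\sigma_k]$: the values of the $i$-th block are shifted
  by the total length of the blocks lying below it, that is, of the blocks $j$ with
  $\tau(j) < \tau(i)$. List positions start at 0.\<close>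

definition inflation :: "nat list \<Rightarrow> nat list list \<Rightarrow> nat list" where
  "inflation \<tau> \<sigma>s =
     concat (map (\<lambda>i. map (\<lambda>x. x + (\<Sum>j\<in>{j\<in>{..<length \<tau>}. \<tau> ! j < \<tau> ! i}. length (\<sigma>s ! j))) (\<sigma>s ! i))
       [0..<length \<tau>])"

lemma "inflation [2,1,3] [[1,2,3], [1], [2,1]] = [2,3,4,1,6,5]"
  by code_simp

definition iota :: "nat \<Rightarrow> nat list" where
  "iota r = [1..<Suc r]"

definition star :: "nat list \<Rightarrow> nat list" where
  "star \<pi> = inflation [2,1] [\<pi>, [1]]"

text \<open>A block decomposition is given by the list of its blocks $\pi_1,\dots,\pi_r$ (not yet
  starred), where $\pi_i$ is the list entry at position $i - 1$.\<close>

definition block_decomposition :: "nat list \<Rightarrow> nat list list \<Rightarrow> bool" where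
  "block_decomposition \<pi> \<pi>s \<longleftrightarrow>
     (\<forall>p\<in>set \<pi>s. p \<in> all_perms \<and> avoids p [3,1,2]) \<and>
     \<pi> = inflation (iota (length \<pi>s)) (map star \<pi>s)"

text \<open>For blocks $\pi_1,\dots,\pi_r$ and $1 \le i \le r$, the permutations
  $\underline{\pi}(i)$ and $\overline{\pi}(i)$. The case $i = 1$ of the former is the
  unstarred $\pi_1$.\<close>

definition lower_part :: "nat list list \<Rightarrow> nat \<Rightarrow> nat list" where
  "lower_part \<pi>s i =
     (if i = 1 then \<pi>s ! 0 else inflation (iota i) (map star (take i \<pi>s)))"

definition upper_part :: "nat list list \<Rightarrow> nat \<Rightarrow> nat list" where
  "upper_part \<pi>s i = inflation (iota (length \<pi>s - i + 1)) (map star (drop (i - 1) \<pi>s))"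

end

theory Submission imports Defs begin

text \<open>A nonempty 312-avoider splits at its entry \<open>1\<close> as \<open>213[\<sigma>, 1, \<tau>]\<close>, the direct sum of the
  starred \<open>\<sigma>\<close> and \<open>\<tau>\<close>. As the blocks of \<open>\<pi>\<close> are sum-indecomposable, an occurrence of \<open>\<pi>\<close> puts
  some number \<open>i\<close> of initial blocks into the starred \<open>\<sigma>\<close> (equivalently, for \<open>i > 0\<close>, the
  \<open>i\<close>-th lower part into \<open>\<sigma>\<close>) and the others into \<open>\<tau>\<close>. Hence the pairs \<open>(\<sigma>, \<tau>)\<close> that give a
  \<open>\<pi>\<close>-avoider are the union over \<open>i\<close> of the rectangles \<open>A i \<times> B i\<close>, where \<open>A i\<close> avoids the \<open>i\<close>-th
  lower and \<open>B i\<close> the \<open>i\<close>-th upper part. \<open>A\<close> increases and \<open>B\<close> decreases, so successive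
  rectangles overlap in \<open>A i \<times> B (i + 1)\<close>, which is the subtracted term.\<close>

section \<open>Pattern containment\<close>

text \<open>An index-free form: both words become projections of one list of pairs, so that picking,
  cutting and concatenating act on both at once.\<close>

lemma same_relative_order_iff_pairs:
  "same_relative_order xs ys \<longleftrightarrow>
     (\<exists>ps. xs = map fst ps \<and> ys = map snd ps \<and>
        (\<forall>p\<in>set ps. \<forall>q\<in>set ps. fst p < fst q \<longleftrightarrow> snd p < snd q))"
proof
  assume *: "same_relative_order xs ys"
  then have len: "length xs = length ys"
    by (simp add: same_relative_order_def)
  then have "xs = map fst (zip xs ys)" "ys = map snd (zip xs ys)"
    by simp_all
  moreover have "\<forall>p\<in>set (zip xs ys). \<forall>q\<in>set (zip xs ys). fst p < fst q \<longleftrightarrow> snd p < snd q"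
    using * by (auto simp: set_zip same_relative_order_def)
  ultimately show "\<exists>ps. xs = map fst ps \<and> ys = map snd ps \<and>
      (\<forall>p\<in>set ps. \<forall>q\<in>set ps. fst p < fst q \<longleftrightarrow> snd p < snd q)"
    by blast
next
  assume "\<exists>ps. xs = map fst ps \<and> ys = map snd ps \<and>
      (\<forall>p\<in>set ps. \<forall>q\<in>set ps. fst p < fst q \<longleftrightarrow> snd p < snd q)"
  then show "same_relative_order xs ys"
    by (auto simp: same_relative_order_def)
qed

lemma same_relative_order_refl: "same_relative_order xs xs"
  by (simp add: same_relative_order_def)

lemma same_relative_order_sym: "same_relative_order xs ys \<Longrightarrow> same_relative_order ys xs"
  by (simp add: same_relative_order_def)

lemma same_relative_order_trans:
  "same_relative_order xs ys \<Longrightarrow> same_relative_order ys zs \<Longrightarrow> same_relative_order xs zs"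
  by (simp add: same_relative_order_def)

lemma same_relative_order_map:
  assumes "\<And>x y. x < y \<longleftrightarrow> g x < g y"
  shows "same_relative_order (map g xs) xs"
  using assms by (simp add: same_relative_order_def)

text \<open>The positions \<open>N\<close> that cut \<open>zs\<close> out of \<open>ys\<close> cut
  the required word out of \<open>xs\<close>. Transitivity of containment rests on this.\<close>

lemma same_relative_order_subseq:
  assumes "same_relative_order xs ys" "subseq zs ys"
  shows "\<exists>ws. subseq ws xs \<and> same_relative_order ws zs"
proof -
  obtain ps where ps: "xs = map fst ps" "ys = map snd ps"
    "\<forall>p\<in>set ps. \<forall>q\<in>set ps. fst p < fst q \<longleftrightarrow> snd p < snd q"
    using assms(1) same_relative_order_iff_pairs by blast
  obtain N where N: "zs = nths ys N"
    using assms(2) subseq_conv_nths by blast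
  have "zs = map snd (nths ps N)"
    using N ps by (simp add: nths_map)
  moreover have "\<forall>p\<in>set (nths ps N). \<forall>q\<in>set (nths ps N). fst p < fst q \<longleftrightarrow> snd p < snd q"
    using ps(3) by (meson in_set_nthsD)
  ultimately have "same_relative_order (map fst (nths ps N)) zs"
    using same_relative_order_iff_pairs by blast
  moreover have "subseq (map fst (nths ps N)) xs"
    using ps by (metis nths_map subseq_conv_nths)
  ultimately show ?thesis by blast
qed

text \<open>The list of pairs is cut where \<open>xs\<close> ends. The last two conclusions are
  conditional so that one rule serves both direct sums (left part below) and stars (left part
  above).\<close>

lemma same_relative_order_append_left:
  assumes "same_relative_order (xs @ ys) zs"
  obtains as bs where "zs = as @ bs" "same_relative_order xs as" "same_relative_order ys bs"
    "\<And>x y. (\<forall>a\<in>set xs. \<forall>b\<in>set ys. a < b) \<Longrightarrow> x \<in> set as \<Longrightarrow> y \<in> set bs \<Longrightarrow> x < y"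
    "\<And>x y. (\<forall>a\<in>set xs. \<forall>b\<in>set ys. b < a) \<Longrightarrow> x \<in> set as \<Longrightarrow> y \<in> set bs \<Longrightarrow> y < x"
proof -
  obtain ps where ps: "xs @ ys = map fst ps" "zs = map snd ps"
    "\<forall>p\<in>set ps. \<forall>q\<in>set ps. fst p < fst q \<longleftrightarrow> snd p < snd q"
    using assms same_relative_order_iff_pairs by blast
  obtain us vs where uv: "ps = us @ vs" "xs = map fst us" "ys = map fst vs"
    using ps(1) by (metis map_eq_append_conv)
  show ?thesis
  proof
    show "zs = map snd us @ map snd vs"
      using ps uv by simp
    show "same_relative_order xs (map snd us)"
      unfolding same_relative_order_iff_pairs using ps(3) uv by (intro exI[of _ us]) simp
    show "same_relative_order ys (map snd vs)"
      unfolding same_relative_order_iff_pairs using ps(3) uv by (intro exI[of _ vs]) simp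
  qed (use ps(3) uv in auto)
qed

lemma same_relative_order_append:
  assumes "same_relative_order xs as" "same_relative_order ys bs"
    and "(\<forall>x\<in>set xs. \<forall>y\<in>set ys. x < y) \<and> (\<forall>a\<in>set as. \<forall>b\<in>set bs. a < b) \<or>
         (\<forall>x\<in>set xs. \<forall>y\<in>set ys. y < x) \<and> (\<forall>a\<in>set as. \<forall>b\<in>set bs. b < a)"
  shows "same_relative_order (xs @ ys) (as @ bs)"
proof -
  obtain ps where ps: "xs = map fst ps" "as = map snd ps"
    "\<forall>p\<in>set ps. \<forall>q\<in>set ps. fst p < fst q \<longleftrightarrow> snd p < snd q"
    using assms(1) same_relative_order_iff_pairs by blast
  obtain qs where qs: "ys = map fst qs" "bs = map snd qs"
    "\<forall>p\<in>set qs. \<forall>q\<in>set qs. fst p < fst q \<longleftrightarrow> snd p < snd q"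
    using assms(2) same_relative_order_iff_pairs by blast
  \<comment> \<open>Both directions are recorded, since a mixed pair from \<open>ps @ qs\<close> may
    be taken in either order.\<close>
  have "\<forall>p\<in>set ps. \<forall>q\<in>set qs. (fst p < fst q \<longleftrightarrow> snd p < snd q) \<and> (fst q < fst p \<longleftrightarrow> snd q < snd p)"
    using assms(3) unfolding ps(1,2) qs(1,2) by (auto; fastforce dest: less_not_sym)
  then have "\<forall>p\<in>set (ps @ qs). \<forall>q\<in>set (ps @ qs). fst p < fst q \<longleftrightarrow> snd p < snd q"
    using ps(3) qs(3) by auto
  then show ?thesis
    unfolding same_relative_order_iff_pairs ps(1,2) qs(1,2)
    by (intro exI[of _ "ps @ qs"]) simp
qed

lemma set_subseq: "subseq xs ys \<Longrightarrow> set xs \<subseteq> set ys"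
  by (auto simp: subseq_conv_nths dest: in_set_nthsD)

lemma contains_refl: "contains \<sigma> \<sigma>"
  unfolding contains_def using same_relative_order_refl by blast

lemma contains_Nil: "contains \<sigma> []"
  unfolding contains_def by (intro exI[of _ "[]"]) (simp add: same_relative_order_def)

lemma Nil_contains_iff: "contains [] \<pi> \<longleftrightarrow> \<pi> = []"
  by (auto simp: contains_def same_relative_order_def dest!: list_emb_Nil2)

lemma contains_subseq: "subseq \<tau> \<sigma> \<Longrightarrow> contains \<sigma> \<tau>"
  unfolding contains_def using same_relative_order_refl by blast

lemma contains_trans: "contains \<sigma> \<tau> \<Longrightarrow> contains \<tau> \<rho> \<Longrightarrow> contains \<sigma> \<rho>"
  unfolding contains_def
  by (meson same_relative_order_subseq same_relative_order_trans subseq_order.order_trans)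

lemma contains_same_relative_order:
  "same_relative_order \<sigma> \<tau> \<Longrightarrow> contains \<sigma> \<tau>"
  unfolding contains_def by blast

text \<open>A strictly monotone relabelling keeps the relative order, so a word and its image
  contain each other. It is applied to the shifts of inflations.\<close>

lemma contains_map_left_iff:
  assumes "\<And>x y. x < y \<longleftrightarrow> g x < g y"
  shows "contains (map g \<sigma>) \<pi> \<longleftrightarrow> contains \<sigma> \<pi>"
  using same_relative_order_map[of g \<sigma>, OF assms]
  by (meson contains_same_relative_order contains_trans same_relative_order_sym)

lemma contains_map_right_iff:
  assumes "\<And>x y. x < y \<longleftrightarrow> g x < g y"
  shows "contains \<sigma> (map g \<pi>) \<longleftrightarrow> contains \<sigma> \<pi>"
  using same_relative_order_map[of g \<pi>, OF assms]
  by (meson contains_same_relative_order contains_trans same_relative_order_sym)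

text \<open>An occurrence is cut where \<sigma> ends. As \<sigma> lies below \<tau>, the two pieces
  of the pattern are ordered in the same way; conversely, occurrences of such pieces can be
  concatenated.\<close>

lemma contains_append_less_iff:
  assumes "\<And>x y. x \<in> set \<sigma> \<Longrightarrow> y \<in> set \<tau> \<Longrightarrow> x < y"
  shows "contains (\<sigma> @ \<tau>) \<pi> \<longleftrightarrow>
    (\<exists>\<pi>1 \<pi>2. \<pi> = \<pi>1 @ \<pi>2 \<and> (\<forall>x\<in>set \<pi>1. \<forall>y\<in>set \<pi>2. x < y) \<and> contains \<sigma> \<pi>1 \<and> contains \<tau> \<pi>2)"
    (is "?L \<longleftrightarrow> ?R")
proof
  assume ?L
  then obtain xs ys where xy: "subseq xs \<sigma>" "subseq ys \<tau>" "same_relative_order (xs @ ys) \<pi>"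
    unfolding contains_def by (metis subseq_appendE)
  then have "\<forall>a\<in>set xs. \<forall>b\<in>set ys. a < b"
    using assms set_subseq by blast
  with xy(3) obtain as bs where "\<pi> = as @ bs" "same_relative_order xs as"
    "same_relative_order ys bs" "\<forall>x\<in>set as. \<forall>y\<in>set bs. x < y"
    by (elim same_relative_order_append_left) blast
  with xy show ?R
    unfolding contains_def by blast
next
  assume ?R
  then obtain \<pi>1 \<pi>2 xs ys where *: "\<pi> = \<pi>1 @ \<pi>2" "\<forall>x\<in>set \<pi>1. \<forall>y\<in>set \<pi>2. x < y"
    "subseq xs \<sigma>" "same_relative_order xs \<pi>1" "subseq ys \<tau>" "same_relative_order ys \<pi>2"
    unfolding contains_def by blast
  then have "\<forall>a\<in>set xs. \<forall>b\<in>set ys. a < b"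
    using assms set_subseq by blast
  with * have "same_relative_order (xs @ ys) \<pi>"
    by (auto intro!: same_relative_order_append)
  then show ?L
    unfolding contains_def using * list_emb_append_mono by blast
qed

section \<open>Patterns in starred permutations\<close>

lemma lessThan_filter: "{j \<in> {..<n}. P j} = set (filter P [0..<n])"
  by auto

lemma star_eq: "star \<pi> = map Suc \<pi> @ [1]"
  \<comment> \<open>For a concrete outer permutation, the index sets in the shifts become explicit
    filtered lists.\<close>
  unfolding star_def inflation_def lessThan_filter by (simp add: upt_rec del: set_filter)

lemma contains_star_self: "contains (star \<pi>) \<pi>"
proof -
  have "contains (star \<pi>) (map Suc \<pi>)"
    unfolding star_eq by (intro contains_subseq subseq_rev_drop_many) simp
  then show ?thesis
    by (simp add: contains_map_right_iff)
qed

text \<open>The final \<open>1\<close> of \<open>star \<sigma>\<close> is its strict minimum,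
  because \<sigma> has no entry \<open>0\<close>. An occurrence either misses it or uses it for the
  last entry of \<pi>, which must then be the minimum of \<pi>.\<close>

lemma contains_star_iff:
  assumes "0 \<notin> set \<sigma>"
  shows "contains (star \<sigma>) \<pi> \<longleftrightarrow> contains \<sigma> \<pi> \<or>
    (\<exists>\<rho> v. \<pi> = \<rho> @ [v] \<and> (\<forall>x\<in>set \<rho>. v < x) \<and> contains \<sigma> \<rho>)"
    (is "?L \<longleftrightarrow> _ \<or> ?R")
proof
  have Suc: "contains (map Suc \<sigma>) \<rho> \<longleftrightarrow> contains \<sigma> \<rho>" for \<rho>
    by (rule contains_map_left_iff) simp
  assume ?L
  then obtain xs ys where xy: "subseq xs (map Suc \<sigma>)" "subseq ys [1]" "same_relative_order (xs @ ys) \<pi>"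
    unfolding contains_def star_eq by (metis subseq_appendE)
  have less: "\<forall>a\<in>set xs. \<forall>b\<in>set ys. b < a"
  proof (intro ballI)
    fix a b assume "a \<in> set xs" "b \<in> set ys"
    then have "a \<in> set (map Suc \<sigma>)" "b = 1"
      using set_subseq[OF xy(1)] set_subseq[OF xy(2)] by auto
    then show "b < a"
      using assms by (auto intro: gr0I)
  qed
  show "contains \<sigma> \<pi> \<or> ?R"
  proof (cases "ys = []")
    case True
    then show ?thesis
      using xy Suc unfolding contains_def by auto
  next
    case False
    with xy(2) have "length ys = 1"
      by (cases ys) (auto dest: list_emb_Nil2 split: if_splits)
    from xy(3) obtain as bs where ab: "\<pi> = as @ bs" "same_relative_order xs as"
      "same_relative_order ys bs" "\<forall>x\<in>set as. \<forall>y\<in>set bs. y < x"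
      using less by (elim same_relative_order_append_left) blast
    then have "length bs = 1"
      using \<open>length ys = 1\<close> by (simp add: same_relative_order_def)
    then obtain v where "bs = [v]"
      by (metis One_nat_def length_0_conv length_Suc_conv)
    moreover have "contains \<sigma> as"
      using ab(2) xy(1) Suc contains_def by blast
    ultimately show ?thesis
      using ab by auto
  qed
next
  assume "contains \<sigma> \<pi> \<or> ?R"
  then show ?L
  proof
    assume "contains \<sigma> \<pi>"
    then show ?L
      using contains_star_self contains_trans by blast
  next
    assume ?R
    then obtain \<rho> v where rv: "\<pi> = \<rho> @ [v]" "\<forall>x\<in>set \<rho>. v < x" "contains (map Suc \<sigma>) \<rho>"
      using contains_map_left_iff[of Suc] by auto
    then obtain xs where xs: "subseq xs (map Suc \<sigma>)" "same_relative_order xs \<rho>"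
      unfolding contains_def by blast
    then have "set xs \<subseteq> Suc ` set \<sigma>"
      using set_subseq by fastforce
    then have "\<forall>x\<in>set xs. 1 < x"
      using assms by (auto intro: gr0I)
    with xs rv have "same_relative_order (xs @ [1]) \<pi>"
      by (auto intro!: same_relative_order_append simp: same_relative_order_def[of "[_]"])
    moreover have "subseq (xs @ [1]) (star \<sigma>)"
      unfolding star_eq using xs by (intro list_emb_append_mono) auto
    ultimately show ?L
      unfolding contains_def by blast
  qed
qed

section \<open>Direct sums\<close>

fun direct_sum :: "nat list list \<Rightarrow> nat list" where
  "direct_sum [] = []"
| "direct_sum (p # ps) = p @ map (\<lambda>x. x + length p) (direct_sum ps)"

lemma direct_sum_append:
  "direct_sum (ps @ qs) =
     direct_sum ps @ map (\<lambda>x. x + length (direct_sum ps)) (direct_sum qs)"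
  by (induction ps) (simp_all add: o_def add_ac)

text \<open>In an identity the blocks below block \<open>i\<close> are those to its left, so each
  shift is a prefix sum of lengths. Removing the first block lowers all later shifts by its length,
  as in the recursion.\<close>

lemma inflation_iota: "inflation (iota (length ps)) ps = direct_sum ps"
proof -
  have "{j \<in> {..<length (iota n)}. iota n ! j < iota n ! i} = {..<i}" if "i < n" for n i
    using that by (auto simp: iota_def simp del: upt_Suc)
  then have "inflation (iota (length ps)) ps =
      concat (map (\<lambda>i. map (\<lambda>x. x + (\<Sum>j<i. length (ps ! j))) (ps ! i)) [0..<length ps])"
    unfolding inflation_def by (intro arg_cong[of _ _ concat] map_cong) (auto simp: iota_def simp del: upt_Suc)
  also have "\<dots> = direct_sum ps"
  proof (induction ps)
    case (Cons p ps)
    have "[0..<length (p # ps)] = 0 # map Suc [0..<length ps]"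
      by (simp add: map_Suc_upt upt_conv_Cons del: upt_Suc)
    then show ?case
      by (simp add: sum.lessThan_Suc_shift o_def map_concat del: sum.lessThan_Suc flip: Cons.IH) (simp add: add_ac)
  qed simp
  finally show ?thesis .
qed

text \<open>Starred permutations are sum-indecomposable: as \<open>1\<close> comes last in \<^term>\<open>star p\<close>, a cut
  inside that block would put it above an earlier entry.\<close>

lemma direct_sum_star_split:
  assumes "direct_sum (map star ps) = \<rho>1 @ \<rho>2" "\<forall>x\<in>set \<rho>1. \<forall>y\<in>set \<rho>2. x < y"
  shows "\<exists>i\<le>length ps. \<rho>1 = direct_sum (map star (take i ps)) \<and>
    \<rho>2 = map (\<lambda>x. x + length \<rho>1) (direct_sum (map star (drop i ps)))"
  using assms
proof (induction ps arbitrary: \<rho>1 \<rho>2)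
  case (Cons p ps)
  let ?m = "\<lambda>x. x + length (star p)"
  have eq: "star p @ map ?m (direct_sum (map star ps)) = \<rho>1 @ \<rho>2"
    using Cons.prems(1) by simp
  \<comment> \<open>Either the cut falls before the end of the first block, or the whole first block
    belongs to \<open>\<rho>1\<close> and the cut is one of the remaining sum.\<close>
  then consider us where "star p = \<rho>1 @ us" "us @ map ?m (direct_sum (map star ps)) = \<rho>2" "us \<noteq> []"
    | us where "\<rho>1 = star p @ us" "map ?m (direct_sum (map star ps)) = us @ \<rho>2"
    unfolding append_eq_append_conv2 by (metis append_Nil append_Nil2)
  then show ?case
  proof cases
    case 1
    have "1 \<in> set \<rho>2"
      using 1 by (metis Un_iff last_in_set last_appendR last_snoc set_append star_eq)
    moreover have "1 \<le> x" if "x \<in> set \<rho>1" for x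
    proof -
      have "x \<in> set (star p)"
        using that 1(1) by simp
      then show ?thesis
        by (auto simp: star_eq)
    qed
    ultimately have "set \<rho>1 = {}"
      using Cons.prems(2) by (meson equals0I leD)
    with Cons.prems show ?thesis
      by (intro exI[of _ 0]) simp
  next
    case 2
    then obtain as bs where ab: "direct_sum (map star ps) = as @ bs" "us = map ?m as" "\<rho>2 = map ?m bs"
      by (auto simp: map_eq_append_conv)
    moreover have "\<forall>x\<in>set as. \<forall>y\<in>set bs. x < y"
    proof (intro ballI)
      fix x y assume "x \<in> set as" "y \<in> set bs"
      then have "?m x \<in> set \<rho>1" "?m y \<in> set \<rho>2"
        using 2(1) ab(2,3) by auto
      then show "x < y"
        using Cons.prems(2) by fastforce
    qed
    ultimately obtain i where i: "i \<le> length ps" "as = direct_sum (map star (take i ps))"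
      "bs = map (\<lambda>x. x + length as) (direct_sum (map star (drop i ps)))"
      using Cons.IH by blast
    then show ?thesis
      using ab 2 by (intro exI[of _ "Suc i"]) (auto simp: o_def add_ac)
  qed
qed simp

section \<open>Lower and upper parts of a block decomposition\<close>

lemma lower_part_eq:
  assumes "1 \<le> i" "i \<le> length ps"
  shows "lower_part ps i = (if i = 1 then ps ! 0 else direct_sum (map star (take i ps)))"
  using assms inflation_iota[of "map star (take i ps)"] by (simp add: lower_part_def min_absorb2)

lemma upper_part_eq:
  assumes "1 \<le> i" "i \<le> length ps"
  shows "upper_part ps i = direct_sum (map star (drop (i - 1) ps))"
  using assms inflation_iota[of "map star (drop (i - 1) ps)"]
  by (simp add: upper_part_def Suc_diff_le)

lemma contains_direct_sum_append_left: "contains (direct_sum (ps @ qs)) (direct_sum ps)"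
  unfolding direct_sum_append by (intro contains_subseq subseq_rev_drop_many) simp

lemma contains_direct_sum_append_right: "contains (direct_sum (ps @ qs)) (direct_sum qs)"
proof -
  let ?m = "map (\<lambda>x. x + length (direct_sum ps)) (direct_sum qs)"
  have "contains (direct_sum (ps @ qs)) ?m"
    unfolding direct_sum_append by (intro contains_subseq subseq_drop_many) simp
  then show ?thesis
    by (subst (asm) contains_map_right_iff) simp_all
qed

lemma contains_direct_sum_take:
  assumes "i \<le> j"
  shows "contains (direct_sum (map star (take j ps))) (direct_sum (map star (take i ps)))"
proof -
  obtain d where d: "j = i + d"
    using assms le_Suc_ex by blast
  show ?thesis
    using contains_direct_sum_append_left[of "map star (take i ps)" "map star (take d (drop i ps))"]
    by (simp add: d take_add)
qed

lemma contains_direct_sum_drop: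
  assumes "i \<le> j"
  shows "contains (direct_sum (map star (drop i ps))) (direct_sum (map star (drop j ps)))"
proof -
  obtain d where d: "j = d + i"
    using assms le_Suc_ex add.commute by metis
  show ?thesis
    using contains_direct_sum_append_right[of "map star (take d (drop i ps))" "map star (drop j ps)"]
    by (simp add: d flip: map_append drop_drop)
qed

text \<open>Lower parts are nested prefixes of blocks, except that the first is unstarred; it is
  reached through its starred form.\<close>

lemma contains_lower_part:
  assumes "1 \<le> i" "i \<le> j" "j \<le> length ps"
  shows "contains (lower_part ps j) (lower_part ps i)"
proof (cases "i = 1 \<and> j \<noteq> 1")
  case True
  then have "direct_sum (map star (take i ps)) = star (ps ! 0)"
    using assms by (cases ps) auto
  then show ?thesis
    using True assms contains_direct_sum_take[of i j ps] contains_star_self contains_trans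
    by (fastforce simp: lower_part_eq)
next
  case False
  then show ?thesis
    using assms contains_direct_sum_take[of i j ps] contains_refl by (auto simp: lower_part_eq)
qed

text \<open>With at least two blocks the last entry of the pattern is not its minimum, so the final
  \<open>1\<close> of \<^term>\<open>star \<sigma>\<close> is useless; with one block it only matches the final \<open>1\<close> of the block.\<close>

lemma contains_star_direct_sum_take_iff:
  assumes "0 \<notin> set \<sigma>" "1 \<le> i" "i \<le> length ps" "\<And>p. p \<in> set ps \<Longrightarrow> 0 \<notin> set p"
  shows "contains (star \<sigma>) (direct_sum (map star (take i ps))) \<longleftrightarrow> contains \<sigma> (lower_part ps i)"
proof (cases "i = 1")
  case True
  then have "direct_sum (map star (take i ps)) = star (ps ! 0)"
    using assms by (cases ps) auto
  moreover have "contains (star \<sigma>) (star p) \<longleftrightarrow> contains \<sigma> p" if p: "0 \<notin> set p" for p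
    unfolding contains_star_iff[OF assms(1)]
  proof
    assume "contains \<sigma> (star p) \<or>
      (\<exists>\<rho> v. star p = \<rho> @ [v] \<and> (\<forall>x\<in>set \<rho>. v < x) \<and> contains \<sigma> \<rho>)"
    then show "contains \<sigma> p"
      using contains_trans[OF _ contains_star_self]
      by (auto simp: star_eq contains_map_right_iff)
  next
    assume "contains \<sigma> p"
    with p have "star p = map Suc p @ [1] \<and> (\<forall>x\<in>set (map Suc p). 1 < x) \<and> contains \<sigma> (map Suc p)"
      by (auto simp: star_eq contains_map_right_iff intro: Suc_lessI gr0I)
    then show "contains \<sigma> (star p) \<or>
      (\<exists>\<rho> v. star p = \<rho> @ [v] \<and> (\<forall>x\<in>set \<rho>. v < x) \<and> contains \<sigma> \<rho>)"
      by blast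
  qed
  moreover have "0 \<notin> set (ps ! 0)"
    by (intro assms(4) nth_mem) (use assms(2,3) in linarith)
  ultimately show ?thesis
    using True assms by (simp add: lower_part_eq)
next
  case False
  then obtain p q qs where pq: "take i ps = p # q # qs"
    using assms by (cases ps; cases "tl ps"; cases i; cases "i - 1") auto
  let ?d = "direct_sum (map star (take i ps))"
  have "\<not> (\<exists>\<rho> v. ?d = \<rho> @ [v] \<and> (\<forall>x\<in>set \<rho>. v < x))"
  proof
    assume "\<exists>\<rho> v. ?d = \<rho> @ [v] \<and> (\<forall>x\<in>set \<rho>. v < x)"
    then obtain \<rho> v where v: "?d = \<rho> @ [v]" "\<forall>x\<in>set \<rho>. v < x"
      by blast
    let ?t = "map (\<lambda>x. x + length (star p)) (direct_sum (map star (q # qs)))"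
    have d: "?d = star p @ ?t" "?t \<noteq> []"
      by (simp_all add: pq star_eq)
    then have "star p @ butlast ?t = \<rho>" "last ?t = v"
      using v(1) by (metis butlast_append butlast_snoc, metis last_appendR last_snoc)
    \<comment> \<open>The entry \<open>1\<close> of \<open>star p\<close> lies in \<rho>, which
      forces \<open>v = 0\<close>; but the shift makes every entry of \<open>?t\<close>
      positive.\<close>
    then have "v < 1" "v \<in> set ?t"
      using v(2) d(2) last_in_set by (fastforce simp: star_eq, blast)
    then show False
      by (auto simp: star_eq)
  qed
  then show ?thesis
    using False assms contains_star_iff[OF assms(1)] by (auto simp: lower_part_eq)
qed

section \<open>Splitting 312-avoiders at the entry 1\<close>

text \<open>This is \<open>213[\<sigma>, 1, \<tau>]\<close> as the direct sum of
  \<open>star \<sigma>\<close> and \<tau>; the shift is the length of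
  \<open>star \<sigma>\<close>.\<close>

definition join :: "nat list \<Rightarrow> nat list \<Rightarrow> nat list" where
  "join \<sigma> \<tau> = star \<sigma> @ map (\<lambda>x. x + Suc (length \<sigma>)) \<tau>"

lemma inflation_213: "inflation [2,1,3] [\<sigma>, [1], \<tau>] = join \<sigma> \<tau>"
  unfolding join_def star_eq inflation_def lessThan_filter
  by (simp add: upt_rec del: set_filter)

lemma perms_iff: "\<sigma> \<in> perms n \<longleftrightarrow> set \<sigma> = {1..n} \<and> distinct \<sigma>"
  by (auto simp: perms_def permutations_of_set_def)

lemma length_perms: "\<sigma> \<in> perms n \<Longrightarrow> length \<sigma> = n"
  by (auto simp: perms_iff dest: distinct_card)

lemma finite_avoiders: "finite (avoiders n P)"
  by (simp add: avoiders_def perms_def)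

section \<open>Patterns in a join\<close>

lemma contains_join_iff:
  assumes "\<sigma> \<in> perms k" "\<tau> \<in> perms m"
  shows "contains (join \<sigma> \<tau>) \<pi> \<longleftrightarrow>
    (\<exists>\<pi>1 \<pi>2. \<pi> = \<pi>1 @ \<pi>2 \<and> (\<forall>x\<in>set \<pi>1. \<forall>y\<in>set \<pi>2. x < y) \<and>
       contains (star \<sigma>) \<pi>1 \<and> contains \<tau> \<pi>2)"
proof -
  have "x < y" if "x \<in> set (star \<sigma>)" "y \<in> set (map (\<lambda>x. x + Suc (length \<sigma>)) \<tau>)" for x y
    using that assms by (auto simp: star_eq length_perms perms_iff)
  then show ?thesis
    unfolding join_def by (subst contains_append_less_iff) (auto simp: contains_map_left_iff)
qed

text \<open>The pattern 312 is sum-indecomposable, so it lies on one side of the join; its last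
  entry is not its minimum, so the \<open>1\<close> of \<open>star \<sigma>\<close> does not
  help.\<close>

lemma contains_join_312_iff:
  assumes "\<sigma> \<in> perms k" "\<tau> \<in> perms m"
  shows "contains (join \<sigma> \<tau>) [3,1,2] \<longleftrightarrow> contains \<sigma> [3,1,2] \<or> contains \<tau> [3,1,2]"
proof -
  have "0 \<notin> set \<sigma>"
    using assms(1) by (simp add: perms_iff)
  then have star: "contains (star \<sigma>) [3,1,2] \<longleftrightarrow> contains \<sigma> [3,1,2]"
    by (subst contains_star_iff) (auto simp: append_eq_Cons_conv Cons_eq_append_conv)
  have split: "([3,1,2] = \<pi>1 @ \<pi>2 \<and> (\<forall>x\<in>set \<pi>1. \<forall>y\<in>set \<pi>2. x < y)) \<longleftrightarrow>
      \<pi>1 = [] \<and> \<pi>2 = [3,1,2] \<or> \<pi>1 = [3,1,2] \<and> \<pi>2 = []" for \<pi>1 \<pi>2 :: "nat list"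
    by (auto simp: append_eq_Cons_conv Cons_eq_append_conv)
  have "contains (join \<sigma> \<tau>) [3,1,2] \<longleftrightarrow>
      (\<exists>\<pi>1 \<pi>2. (\<pi>1 = [] \<and> \<pi>2 = [3,1,2] \<or> \<pi>1 = [3,1,2] \<and> \<pi>2 = []) \<and>
         contains (star \<sigma>) \<pi>1 \<and> contains \<tau> \<pi>2)"
    by (simp only: contains_join_iff[OF assms] conj_assoc[symmetric] split)
  also have "\<dots> \<longleftrightarrow> contains (star \<sigma>) [] \<and> contains \<tau> [3,1,2] \<or>
      contains (star \<sigma>) [3,1,2] \<and> contains \<tau> []"
    by auto
  finally show ?thesis
    using star contains_Nil by auto
qed

text \<open>These bounds ensure that the first \<open>i\<close> blocks lie below the shifted
  remaining ones.\<close>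

lemma set_direct_sum_star:
  assumes "set ps \<subseteq> all_perms"
  shows "set (direct_sum (map star ps)) \<subseteq> {1..length (direct_sum (map star ps))}"
  using assms
proof (induction ps)
  case (Cons p ps)
  then have "set p = {1..length p}"
    using length_perms by (auto simp: all_perms_def perms_iff)
  then have "set (star p) \<subseteq> {1..length (star p)}"
    by (auto simp: star_eq)
  with Cons show ?case
    by fastforce
qed simp

text \<open>The pattern can be cut only between blocks. Its first \<open>i\<close> blocks go into
  \<open>star \<sigma>\<close>, which for \<open>i > 0\<close> means the lower part going into
  \<sigma>; for \<open>i = 0\<close> nothing is required of \<sigma>.\<close>

lemma contains_join_direct_sum_iff:
  assumes "\<sigma> \<in> perms k" "\<tau> \<in> perms m" "set ps \<subseteq> all_perms"
  shows "contains (join \<sigma> \<tau>) (direct_sum (map star ps)) \<longleftrightarrow>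
    (\<exists>i\<le>length ps. (i = 0 \<or> contains \<sigma> (lower_part ps i)) \<and>
       contains \<tau> (direct_sum (map star (drop i ps))))"
    (is "?L \<longleftrightarrow> ?R")
proof -
  have 0: "0 \<notin> set \<sigma>"
    using assms(1) by (simp add: perms_iff)
  have ps: "0 \<notin> set p" if "p \<in> set ps" for p
    using that assms(3) by (auto simp: all_perms_def perms_iff)
  have take: "contains (star \<sigma>) (direct_sum (map star (take i ps))) \<longleftrightarrow>
      i = 0 \<or> contains \<sigma> (lower_part ps i)" if "i \<le> length ps" for i
    using contains_star_direct_sum_take_iff[OF 0, of i ps] that ps contains_Nil by (cases "i = 0") auto
  show ?thesis
  proof
    assume ?L
    then show ?R
      unfolding contains_join_iff[OF assms(1,2)] using take
      by (fastforce dest!: direct_sum_star_split simp: contains_map_right_iff)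
  next
    assume ?R
    then obtain i where i: "i \<le> length ps" "contains (star \<sigma>) (direct_sum (map star (take i ps)))"
      "contains \<tau> (direct_sum (map star (drop i ps)))"
      using take by blast
    let ?a = "direct_sum (map star (take i ps))"
    let ?b = "map (\<lambda>x. x + length ?a) (direct_sum (map star (drop i ps)))"
    have "direct_sum (map star ps) = ?a @ ?b"
      by (metis append_take_drop_id direct_sum_append map_append)
    moreover have "x < y" if "x \<in> set ?a" "y \<in> set ?b" for x y
    proof -
      have "set (take i ps) \<subseteq> all_perms" "set (drop i ps) \<subseteq> all_perms"
        using assms(3) set_take_subset set_drop_subset by fast+
      then have "x \<le> length ?a" "length ?a < y"
        using that set_direct_sum_star[of "take i ps"] set_direct_sum_star[of "drop i ps"]
        by auto
      then show ?thesis
        by simp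
    qed
    ultimately show ?L
      unfolding contains_join_iff[OF assms(1,2)] using i
      by (intro exI[of _ ?a] exI[of _ ?b]) (simp add: contains_map_right_iff)
  qed
qed

text \<open>As \<open>i\<close> grows, the \<open>i\<close>-th lower part becomes easier to avoid and the \<open>i\<close>-th upper part
  harder, so the \<open>i\<close> to take is the least one for which \<open>\<sigma>\<close> avoids the lower part.\<close>

lemma avoids_join_direct_sum_iff:
  assumes "\<sigma> \<in> perms k" "\<tau> \<in> perms m" "set ps \<subseteq> all_perms"
  shows "avoids (join \<sigma> \<tau>) (direct_sum (map star ps)) \<longleftrightarrow>
    (\<exists>i\<in>{1..length ps}. avoids \<sigma> (lower_part ps i) \<and> avoids \<tau> (upper_part ps i))"
    (is "?L \<longleftrightarrow> ?R")
proof
  assume L: ?L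
  have cut: "\<not> contains \<tau> (direct_sum (map star (drop i ps)))"
    if "i \<le> length ps" "i = 0 \<or> contains \<sigma> (lower_part ps i)" for i
    using L that contains_join_direct_sum_iff[OF assms] by (auto simp: avoids_def)
  let ?P = "\<lambda>i. 1 \<le> i \<and> i \<le> length ps \<and> avoids \<sigma> (lower_part ps i)"
  \<comment> \<open>At \<open>i = length ps\<close> the remaining sum is empty and hence contained
    in \<tau>. So \<open>ps\<close> is nonempty and \<sigma> avoids the last lower part.\<close>
  have "?P (length ps)"
    using cut[of "length ps"] contains_Nil by (cases ps) (auto simp: avoids_def)
  then obtain i where P: "?P i" and least: "\<forall>j<i. \<not> ?P j"
    using exists_least_iff[of ?P] by blast
  \<comment> \<open>By minimality, \<open>i = 1\<close> or \<sigma> contains the lower part at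
    \<open>i - 1\<close>; in both cases \<open>cut\<close> applies at \<open>i - 1\<close>.\<close>
  then have "\<not> ?P (i - 1)" "i - 1 \<le> length ps"
    by auto
  then have "avoids \<tau> (direct_sum (map star (drop (i - 1) ps)))"
    using P cut[of "i - 1"] unfolding avoids_def by (cases "i = 1") auto
  then show ?R
    using P by (intro bexI[of _ i]) (auto simp: upper_part_eq)
next
  assume ?R
  then obtain i where i: "1 \<le> i" "i \<le> length ps" "\<not> contains \<sigma> (lower_part ps i)"
    "\<not> contains \<tau> (direct_sum (map star (drop (i - 1) ps)))"
    by (auto simp: avoids_def upper_part_eq)
  have "\<not> contains \<tau> (direct_sum (map star (drop j ps)))"
    if "j \<le> length ps" "j = 0 \<or> contains \<sigma> (lower_part ps j)" for j
  \<comment> \<open>A cut at \<open>j \<ge> i\<close> would put the \<open>i\<close>-th lower part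
    into \<sigma>; a cut at \<open>j < i\<close> would put the \<open>i\<close>-th upper part into
    \<tau>.\<close>
  proof (cases "i \<le> j")
    case True
    then show ?thesis
      using that i contains_lower_part[of i j ps] contains_trans by auto
  next
    case False
    then show ?thesis
      using i(4) contains_direct_sum_drop[of j "i - 1" ps] contains_trans by auto
  qed
  then show ?L
    using contains_join_direct_sum_iff[OF assms] by (auto simp: avoids_def)
qed

section \<open>Existence and uniqueness of the splitting\<close>

lemma join_perms:
  assumes "\<sigma> \<in> perms k" "\<tau> \<in> perms m"
  shows "join \<sigma> \<tau> \<in> perms (Suc (k + m))"
proof -
  have "(\<lambda>x. Suc (x + k)) ` {Suc 0..m} = {Suc (Suc k)..Suc (k + m)}"
    using image_add_atLeastAtMost'[of "Suc k" 1 m] by (simp add: add_ac)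
  then have "set (join \<sigma> \<tau>) = {2..Suc k} \<union> {1} \<union> {Suc (Suc k)..Suc (k + m)}"
    using assms length_perms[OF assms(1)]
    by (simp add: perms_iff join_def star_eq image_Suc_atLeastAtMost numeral_2_eq_2)
  also have "\<dots> = {1..Suc (k + m)}"
    unfolding set_eq_iff Un_iff atLeastAtMost_iff singleton_iff by presburger
  finally have "set (join \<sigma> \<tau>) = {1..Suc (k + m)}" .
  moreover have "distinct (join \<sigma> \<tau>)"
    using assms length_perms[OF assms(1)]
    by (auto simp: perms_iff join_def star_eq distinct_map inj_on_def)
  ultimately show ?thesis
    by (simp add: perms_iff)
qed

text \<open>The entry \<open>1\<close> occurs only once in a join, so its position separates the two
  shifted words.\<close>

lemma join_inject:
  assumes "\<sigma> \<in> perms k" "\<tau> \<in> perms m" "\<sigma>' \<in> perms k'" "\<tau>' \<in> perms m'"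
  shows "join \<sigma> \<tau> = join \<sigma>' \<tau>' \<longleftrightarrow> \<sigma> = \<sigma>' \<and> \<tau> = \<tau>'"
proof
  have inj: "inj (\<lambda>x. x + Suc n)" for n
    by (simp add: inj_on_def)
  assume "join \<sigma> \<tau> = join \<sigma>' \<tau>'"
  moreover have "1 \<notin> set (map Suc \<sigma>)" "1 \<notin> set (map (\<lambda>x. x + Suc (length \<sigma>)) \<tau>)"
    using assms by (auto simp: perms_iff)
  ultimately have "map Suc \<sigma> = map Suc \<sigma>' \<and>
      map (\<lambda>x. x + Suc (length \<sigma>)) \<tau> = map (\<lambda>x. x + Suc (length \<sigma>')) \<tau>'"
    by (simp only: join_def star_eq append_assoc append_Cons append_Nil append_Cons_eq_iff not_False_eq_True)
  then have "\<sigma> = \<sigma>'" "map (\<lambda>x. x + Suc (length \<sigma>)) \<tau> = map (\<lambda>x. x + Suc (length \<sigma>)) \<tau>'"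
    by auto
  then show "\<sigma> = \<sigma>' \<and> \<tau> = \<tau>'"
    using map_injective[OF _ inj] by blast
qed simp

text \<open>For nonempty \<open>X\<close> the boundary is \<open>Max X\<close>: members of the union
  up to it cannot be in \<open>Y\<close>, and those above it cannot be in \<open>X\<close>.\<close>

lemma interval_split:
  fixes X Y :: "nat set"
  assumes "X \<union> Y = {a..<b}" "\<And>x y. x \<in> X \<Longrightarrow> y \<in> Y \<Longrightarrow> x < y"
  shows "X = {a..<a + card X} \<and> Y = {a + card X..<b}"
proof (cases "X = {}")
  case False
  have "finite X"
    using assms(1) by (metis finite_Un finite_atLeastLessThan)
  then have M: "Max X \<in> X" "\<And>x. x \<in> X \<Longrightarrow> x \<le> Max X"
    using False by auto
  have X: "X = {a..<Suc (Max X)}"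
  proof (intro equalityI subsetI)
    fix x assume "x \<in> X"
    then show "x \<in> {a..<Suc (Max X)}"
      using M(2) assms(1) by fastforce
  next
    have "Max X \<in> {a..<b}"
      using M(1) assms(1) by blast
    moreover fix x assume x: "x \<in> {a..<Suc (Max X)}"
    ultimately have "x \<in> X \<union> Y"
      unfolding assms(1) by simp
    with x show "x \<in> X"
      using assms(2)[OF M(1)] by fastforce
  qed
  have "a \<le> Max X"
    using M(1) assms(1) by auto
  then have "a + card X = Suc (Max X)"
    by (subst X) simp
  moreover have "Y = {Suc (Max X)..<b}"
  proof (intro equalityI subsetI)
    fix y assume "y \<in> Y"
    then show "y \<in> {Suc (Max X)..<b}"
      using assms(1) assms(2)[OF M(1)] by fastforce
  next
    fix y assume "y \<in> {Suc (Max X)..<b}"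
    then show "y \<in> Y"
      using assms(1) M(2)[of y] \<open>a \<le> Max X\<close> by fastforce
  qed
  ultimately show ?thesis
    using X by simp
qed (use assms in simp)

lemma avoids_312_split:
  assumes "avoids (A @ c # B) [3,1,2]" "a \<in> set A" "b \<in> set B" "c < a" "c < b" "a \<noteq> b"
  shows "a < b"
proof (rule ccontr)
  assume "\<not> a < b"
  then have "same_relative_order [a, c, b] [3,1,2]"
    using assms by (auto simp: same_relative_order_def less_Suc_eq nth_Cons')
  moreover have "subseq ([a] @ [c, b]) (A @ c # B)"
    by (intro list_emb_append_mono) (use assms in \<open>simp_all add: subseq_singleton_left\<close>)
  ultimately have "contains (A @ c # B) [3,1,2]"
    unfolding contains_def by auto
  with assms show False
    by (simp add: avoids_def)
qed

text \<open>Entries before the \<open>1\<close> are smaller than those after it, since otherwise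
  they would form a 312 with it. Both sides thus occupy intervals of values, and shifting these down
  gives \<sigma> and \<tau>.\<close>

lemma avoider_312_join:
  assumes "\<rho> \<in> avoiders (Suc n) {[3,1,2]}"
  obtains k \<sigma> \<tau> where "k \<le> n" "\<sigma> \<in> avoiders k {[3,1,2]}" "\<tau> \<in> avoiders (n - k) {[3,1,2]}"
    "\<rho> = join \<sigma> \<tau>"
proof -
  have \<rho>: "set \<rho> = {1..Suc n}" "distinct \<rho>" "avoids \<rho> [3,1,2]"
    using assms by (auto simp: avoiders_def perms_iff)
  then have "1 \<in> set \<rho>"
    by simp
  then obtain A B where AB: "\<rho> = A @ 1 # B"
    by (meson split_list)
  have un: "set A \<union> set B = {2..<n + 2}"
  proof -
    have "set A \<union> set B = set \<rho> - {1}"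
      using \<rho>(2) by (auto simp: AB)
    also have "\<dots> = {2..<n + 2}"
      unfolding \<rho>(1) by auto
    finally show ?thesis .
  qed
  have "a < b" if "a \<in> set A" "b \<in> set B" for a b
  proof (rule avoids_312_split)
    show "avoids (A @ 1 # B) [3,1,2]"
      using \<rho>(3) AB by simp
    have "a \<in> {2..<n + 2}" "b \<in> {2..<n + 2}"
      using that un by auto
    then show "1 < a" "1 < b"
      by simp_all
    show "a \<noteq> b"
      using that \<rho>(2) AB by auto
  qed (use that in simp_all)
  then have *: "set A = {2..<2 + card (set A)} \<and> set B = {2 + card (set A)..<n + 2}"
    by (intro interval_split un)
  define k where "k = length A"
  have "card (set A) = k"
    using \<rho>(2) by (simp add: AB k_def distinct_card)
  with * have A: "set A = {2..<2 + k}" and B: "set B = {2 + k..<n + 2}"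
    by simp_all
  have "length \<rho> = Suc n"
    using \<rho> by (metis card_atLeastAtMost diff_Suc_1 distinct_card)
  then have k: "k \<le> n"
    by (simp add: AB k_def)
  \<comment> \<open>The truncated subtractions lose nothing: entries of \<open>A\<close> are at
    least \<open>2\<close>, those of \<open>B\<close> at least \<open>2 + k\<close>.\<close>
  define \<sigma> \<tau> where "\<sigma> = map (\<lambda>x. x - 1) A" and "\<tau> = map (\<lambda>x. x - Suc k) B"
  have "map Suc \<sigma> = A" "map (\<lambda>x. x + Suc k) \<tau> = B"
    unfolding \<sigma>_def \<tau>_def map_map by (rule map_idI; use A B in auto)+
  then have j: "\<rho> = join \<sigma> \<tau>"
    by (simp add: AB join_def star_eq \<sigma>_def k_def)
  have "set \<sigma> = {1..k}"
  proof -
    have "Suc ` set \<sigma> = {2..<2 + k}"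
      using A \<open>map Suc \<sigma> = A\<close> by (metis list.set_map)
    also have "\<dots> = Suc ` {1..k}"
      unfolding image_Suc_atLeastAtMost by (simp add: set_eq_iff) presburger
    finally show ?thesis
      by (simp only: inj_image_eq_iff[OF inj_Suc])
  qed
  moreover have "set \<tau> = {1..n - k}"
  proof -
    have "(\<lambda>x. x + Suc k) ` set \<tau> = {2 + k..<n + 2}"
      using B \<open>map (\<lambda>x. x + Suc k) \<tau> = B\<close> by (metis list.set_map)
    also have "\<dots> = (\<lambda>x. x + Suc k) ` {1..n - k}"
      using k unfolding image_add_atLeastAtMost' by (simp add: set_eq_iff) presburger
    finally show ?thesis
      by (subst (asm) inj_image_eq_iff) (auto simp: inj_on_def)
  qed
  moreover have "distinct \<sigma>" "distinct \<tau>"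
    using \<rho>(2) \<open>map Suc \<sigma> = A\<close> \<open>map (\<lambda>x. x + Suc k) \<tau> = B\<close> unfolding AB
    by (auto simp: distinct_map)
  ultimately have p: "\<sigma> \<in> perms k" "\<tau> \<in> perms (n - k)"
    by (simp_all add: perms_iff)
  then have "avoids \<sigma> [3,1,2]" "avoids \<tau> [3,1,2]"
    using \<rho>(3) contains_join_312_iff[OF p] by (simp_all add: j avoids_def)
  with p k j show ?thesis
    by (intro that) (simp_all add: avoiders_def)
qed

section \<open>The recurrence\<close>

text \<open>By monotonicity, a new rectangle meets the union of all earlier ones exactly in
  \<open>A r \<times> B (Suc r)\<close>, so induction on \<open>r\<close> needs only one correction
  per step.\<close>

lemma sum_staircase:
  fixes w :: "'a \<Rightarrow> 'b::comm_ring_1" and v :: "'c \<Rightarrow> 'b" and r :: nat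
  assumes "\<And>i. finite (A i)" "\<And>i. finite (B i)"
    and "\<forall>j\<le>r. \<forall>i\<in>{1..j}. A i \<subseteq> A j" "\<forall>j\<le>r. \<forall>i\<in>{1..j}. B j \<subseteq> B i"
  shows "(\<Sum>(x, y)\<in>(\<Union>i\<in>{1..r}. A i \<times> B i). w x * v y) =
    (\<Sum>i=1..r. sum w (A i) * sum v (B i)) - (\<Sum>i=1..r - 1. sum w (A i) * sum v (B (i + 1)))"
  using assms(3,4)
proof (induction r)
  case (Suc r)
  have prod: "(\<Sum>(x, y)\<in>A i \<times> B j. w x * v y) = sum w (A i) * sum v (B j)" for i j
    by (simp add: sum_product sum.cartesian_product)
  let ?U = "\<Union>i\<in>{1..r}. A i \<times> B i"
  have IH: "(\<Sum>(x, y)\<in>?U. w x * v y) = (\<Sum>i=1..r. sum w (A i) * sum v (B i)) -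
      (\<Sum>i=1..r - 1. sum w (A i) * sum v (B (i + 1)))"
    using Suc by simp
  show ?case
  proof (cases "r = 0")
    case True
    then show ?thesis
      by (simp add: prod)
  next
    case False
    have "?U \<inter> A (Suc r) \<times> B (Suc r) = A r \<times> B (Suc r)"
    proof (intro equalityI subsetI)
      fix z assume "z \<in> ?U \<inter> A (Suc r) \<times> B (Suc r)"
      then obtain i where "1 \<le> i" "i \<le> r" "z \<in> A i \<times> B (Suc r)"
        by auto
      then show "z \<in> A r \<times> B (Suc r)"
        using Suc.prems(1) by (auto dest!: spec[of _ r])
    next
      fix z assume "z \<in> A r \<times> B (Suc r)"
      then show "z \<in> ?U \<inter> A (Suc r) \<times> B (Suc r)"
        using False Suc.prems by (auto intro!: bexI[of _ r] dest!: spec[of _ "Suc r"])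
    qed
    moreover have "(\<Union>i\<in>{1..Suc r}. A i \<times> B i) = ?U \<union> A (Suc r) \<times> B (Suc r)"
      by (auto simp: atLeastAtMostSuc_conv)
    moreover have "(\<Sum>(x, y)\<in>?U \<union> A (Suc r) \<times> B (Suc r). w x * v y) =
        (\<Sum>(x, y)\<in>?U. w x * v y) + (\<Sum>(x, y)\<in>A (Suc r) \<times> B (Suc r). w x * v y) -
        (\<Sum>(x, y)\<in>?U \<inter> A (Suc r) \<times> B (Suc r). w x * v y)"
      using assms(1,2) by (intro sum_Un) auto
    moreover have "(\<Sum>i=1..r. sum w (A i) * sum v (B (i + 1))) =
        (\<Sum>i=1..r - 1. sum w (A i) * sum v (B (i + 1))) + sum w (A r) * sum v (B (Suc r))"
      using False by (cases r) simp_all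
    ultimately show ?thesis
      using IH by (simp add: prod)
  qed
qed simp

lemma avoiders_insert: "avoiders n {\<rho>, \<pi>} = {\<sigma> \<in> avoiders n {\<rho>}. avoids \<sigma> \<pi>}"
  by (auto simp: avoiders_def)

lemma avoiders_mono: "contains \<pi>' \<pi> \<Longrightarrow> avoiders n {\<rho>, \<pi>} \<subseteq> avoiders n {\<rho>, \<pi>'}"
  by (auto simp: avoiders_def avoids_def intro: contains_trans)

text \<open>Splitting at \<open>1\<close> is combined with the avoidance criterion for joins. For
  \<open>ps = []\<close> both sides are empty, as every permutation contains the empty
  pattern.\<close>

lemma avoiders_Suc_eq:
  assumes "set ps \<subseteq> all_perms"
  shows "avoiders (Suc n) {[3,1,2], direct_sum (map star ps)} =
    (\<lambda>(k, \<sigma>, \<tau>). join \<sigma> \<tau>) ` (SIGMA k:{0..n}. \<Union>i\<in>{1..length ps}.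
       avoiders k {[3,1,2], lower_part ps i} \<times> avoiders (n - k) {[3,1,2], upper_part ps i})"
    (is "?L = _ ` ?D")
proof (intro equalityI subsetI)
  fix \<rho> assume \<rho>: "\<rho> \<in> ?L"
  then have "\<rho> \<in> avoiders (Suc n) {[3,1,2]}" and av: "avoids \<rho> (direct_sum (map star ps))"
    by (simp_all add: avoiders_insert)
  then obtain k \<sigma> \<tau> where *: "k \<le> n" "\<sigma> \<in> avoiders k {[3,1,2]}"
    "\<tau> \<in> avoiders (n - k) {[3,1,2]}" "\<rho> = join \<sigma> \<tau>"
    by (elim avoider_312_join)
  then have "\<sigma> \<in> perms k" "\<tau> \<in> perms (n - k)"
    by (simp_all add: avoiders_def)
  then have "\<exists>i\<in>{1..length ps}. avoids \<sigma> (lower_part ps i) \<and> avoids \<tau> (upper_part ps i)"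
    using av assms * by (simp add: avoids_join_direct_sum_iff)
  then have "(k, \<sigma>, \<tau>) \<in> ?D"
    using * by (auto simp: avoiders_insert)
  then show "\<rho> \<in> (\<lambda>(k, \<sigma>, \<tau>). join \<sigma> \<tau>) ` ?D"
    using * by (intro image_eqI[of _ _ "(k, \<sigma>, \<tau>)"]) simp_all
next
  fix \<rho> assume "\<rho> \<in> (\<lambda>(k, \<sigma>, \<tau>). join \<sigma> \<tau>) ` ?D"
  then obtain k \<sigma> \<tau> i where *: "k \<le> n" "i \<in> {1..length ps}"
    "\<sigma> \<in> perms k" "avoids \<sigma> [3,1,2]" "avoids \<sigma> (lower_part ps i)"
    "\<tau> \<in> perms (n - k)" "avoids \<tau> [3,1,2]" "avoids \<tau> (upper_part ps i)" "\<rho> = join \<sigma> \<tau>"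
    by (auto simp: avoiders_def)
  then have "join \<sigma> \<tau> \<in> perms (Suc n)"
    using join_perms[of \<sigma> k \<tau> "n - k"] by simp
  moreover have "avoids \<rho> [3,1,2]"
    using * contains_join_312_iff[of \<sigma> k \<tau> "n - k"] by (simp add: avoids_def)
  moreover have "avoids \<rho> (direct_sum (map star ps))"
    using * avoids_join_direct_sum_iff[of \<sigma> k \<tau> "n - k" ps] assms by blast
  ultimately show "\<rho> \<in> ?L"
    using * by (simp add: avoiders_def)
qed

theorem theorem2p4:
  fixes st :: "nat list \<Rightarrow> nat" and f :: "nat \<Rightarrow> nat \<Rightarrow> nat"
    and \<pi> :: "nat list" and \<pi>s :: "nat list list" and r :: nat and Pats :: "nat list set"
  assumes st_empty: "st [] = 0"
    and st_rec: "\<And>k n \<sigma>1 \<sigma>2. k \<le> n \<Longrightarrow> \<sigma>1 \<in> avoiders k {[3,1,2]} \<Longrightarrow>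
           \<sigma>2 \<in> avoiders (n - k) {[3,1,2]} \<Longrightarrow>
           st (inflation [2,1,3] [\<sigma>1, [1], \<sigma>2]) = f k (n - k) + st \<sigma>1 + st \<sigma>2"
    and pi_perm: "\<pi> \<in> all_perms" and pi_avoids: "avoids \<pi> [3,1,2]"
    and decomp: "block_decomposition \<pi> \<pi>s"
    and r_def: "r = length \<pi>s"
    and Pi_def: "Pats = {[3,1,2], \<pi>}"
  shows "(\<forall>n. gen_poly st (n + 1) Pats =
           (\<Sum>k=0..n. monom 1 (f k (n - k)) *
             ((\<Sum>i=1..r. gen_poly st k {[3,1,2], lower_part \<pi>s i} *
                          gen_poly st (n - k) {[3,1,2], upper_part \<pi>s i})
              - (\<Sum>i=1..r - 1. gen_poly st k {[3,1,2], lower_part \<pi>s i} *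
                          gen_poly st (n - k) {[3,1,2], upper_part \<pi>s (i + 1)})))) \<and>
         gen_poly st 0 Pats = (if \<pi> = [] then 0 else 1)"
proof (intro conjI allI)
  have ps: "set \<pi>s \<subseteq> all_perms" and \<pi>: "\<pi> = direct_sum (map star \<pi>s)"
    using decomp inflation_iota[of "map star \<pi>s"] by (auto simp: block_decomposition_def)
  fix n
  define A where "A = (\<lambda>k i. avoiders k {[3,1,2], lower_part \<pi>s i})"
  define B where "B = (\<lambda>k i. avoiders k {[3,1,2], upper_part \<pi>s i})"
  define D where "D = (\<lambda>k. \<Union>i\<in>{1..r}. A k i \<times> B (n - k) i)"
  let ?j = "\<lambda>(k, \<sigma>, \<tau>). join \<sigma> \<tau>"
  let ?m = "\<lambda>\<sigma>. monom (1::int) (st \<sigma>)"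
  have D: "\<sigma> \<in> avoiders k {[3,1,2]}" "\<tau> \<in> avoiders (n - k) {[3,1,2]}"
    if "(\<sigma>, \<tau>) \<in> D k" for k \<sigma> \<tau>
    using that by (auto simp: D_def A_def B_def avoiders_insert)
  have fin: "finite (A k i)" "finite (B k i)" for k i
    by (simp_all add: A_def B_def finite_avoiders)
  \<comment> \<open>The join determines \<sigma> and \<tau>, and \<open>k\<close> is the length of
    \<sigma>.\<close>
  have inj: "inj_on ?j (SIGMA k:{0..n}. D k)"
  proof (intro inj_onI, clarsimp)
    fix k \<sigma> \<tau> k' \<sigma>' \<tau>'
    assume *: "(\<sigma>, \<tau>) \<in> D k" "(\<sigma>', \<tau>') \<in> D k'" "join \<sigma> \<tau> = join \<sigma>' \<tau>'"
    then have p: "\<sigma> \<in> perms k" "\<tau> \<in> perms (n - k)" "\<sigma>' \<in> perms k'" "\<tau>' \<in> perms (n - k')"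
      using D by (auto simp: avoiders_def)
    then show "k = k' \<and> \<sigma> = \<sigma>' \<and> \<tau> = \<tau>'"
      using join_inject[OF p] * length_perms by metis
  qed
  have "gen_poly st (n + 1) Pats = sum ?m (?j ` (SIGMA k:{0..n}. D k))"
    using avoiders_Suc_eq[OF ps, of n]
    by (simp add: gen_poly_def Pi_def \<pi> D_def A_def B_def r_def)
  also have "\<dots> = (\<Sum>z\<in>(SIGMA k:{0..n}. D k). ?m (?j z))"
    using inj by (simp add: sum.reindex)
  also have "\<dots> = (\<Sum>k=0..n. \<Sum>z\<in>D k. ?m (?j (k, z)))"
    by (subst sum.Sigma) (auto simp: D_def fin intro!: sum.cong)
  also have "\<dots> = (\<Sum>k=0..n. monom 1 (f k (n - k)) * (\<Sum>(\<sigma>, \<tau>)\<in>D k. ?m \<sigma> * ?m \<tau>))"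
    unfolding sum_distrib_left
  proof (intro sum.cong refl, clarsimp)
    fix k \<sigma> \<tau> assume "k \<le> n" "(\<sigma>, \<tau>) \<in> D k"
    then have "st (join \<sigma> \<tau>) = f k (n - k) + st \<sigma> + st \<tau>"
      using st_rec[of k n \<sigma> \<tau>] D unfolding inflation_213 by blast
    then show "?m (join \<sigma> \<tau>) = monom 1 (f k (n - k)) * (?m \<sigma> * ?m \<tau>)"
      by (simp add: mult_monom add_ac)
  qed
  also have "\<dots> = (\<Sum>k=0..n. monom 1 (f k (n - k)) *
      ((\<Sum>i=1..r. sum ?m (A k i) * sum ?m (B (n - k) i))
       - (\<Sum>i=1..r - 1. sum ?m (A k i) * sum ?m (B (n - k) (i + 1)))))"
  proof (intro sum.cong refl arg_cong2[of _ _ _ _ "(*)"])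
    fix k
    show "(\<Sum>(\<sigma>, \<tau>)\<in>D k. ?m \<sigma> * ?m \<tau>) =
      (\<Sum>i=1..r. sum ?m (A k i) * sum ?m (B (n - k) i))
       - (\<Sum>i=1..r - 1. sum ?m (A k i) * sum ?m (B (n - k) (i + 1)))"
      unfolding D_def
    proof (rule sum_staircase)
      \<comment> \<open>Lower parts grow with the index and upper parts shrink, and a larger pattern
        is easier to avoid.\<close>
      show "\<forall>j\<le>r. \<forall>i\<in>{1..j}. A k i \<subseteq> A k j"
        "\<forall>j\<le>r. \<forall>i\<in>{1..j}. B (n - k) j \<subseteq> B (n - k) i"
        unfolding A_def B_def
        by (auto intro!: avoiders_mono contains_lower_part contains_direct_sum_drop
            simp: upper_part_eq r_def)
    qed (simp_all add: fin)
  qed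
  finally show "gen_poly st (n + 1) Pats =
      (\<Sum>k=0..n. monom 1 (f k (n - k)) *
        ((\<Sum>i=1..r. gen_poly st k {[3,1,2], lower_part \<pi>s i} *
                     gen_poly st (n - k) {[3,1,2], upper_part \<pi>s i})
         - (\<Sum>i=1..r - 1. gen_poly st k {[3,1,2], lower_part \<pi>s i} *
                     gen_poly st (n - k) {[3,1,2], upper_part \<pi>s (i + 1)})))"
    by (simp add: gen_poly_def A_def B_def)
next
  \<comment> \<open>The only candidate is \<open>[]\<close>, which contains no pattern but the empty
    one; its monomial is \<open>1\<close> because \<open>st [] = 0\<close>.\<close>
  have "avoiders 0 Pats = (if \<pi> = [] then {} else {[]})"
    by (auto simp: avoiders_def Pi_def avoids_def Nil_contains_iff perms_iff)
  then show "gen_poly st 0 Pats = (if \<pi> = [] then 0 else 1)"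
    by (simp add: gen_poly_def st_empty)
qed

end
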